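(* Let $(X,d)$ be a (nonempty) complete metric space and let $T:X\to CB(X)$ be a multivalued Górnicki mapping. Then $T$ has a fixed point, i.e. there exists $z\in X$ with $z\in Tz$.
   Context: For a metric space $(X,d)$, $CB(X)$ denotes the family of nonempty, closed and bounded subsets of $X$. For $x\in X$ and $A,B\in CB(X)$, $d(x,B)=\inf\{d(x,y):y\in B\}$ and $H(A,B)=\max\{\sup_{x\in A}d(x,B),\sup_{x\in B}d(x,A)\}$ is the Hausdorff metric. A mapping $T:X\to CB(X)$ is called a multivalued Górnicki mapping if there exists $M\in[0,1)$ such that $H(Tx,Ty)\le M[d(x,Tx)+d(y,Ty)+d(x,y)]$ for every $x,y\in X$, and there exist real constants $a\in[0,1)$ and $b\in[0,\infty)$ such that for arbitrary $x\in X$ there exists $u\in X$ with $d(u,Tu)\le a\,d(x,Tx)$ and $d(u,x)\le b\,d(x,Tx)$. *)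

theory Defs
  imports "HOL-Analysis.Analysis"
begin

definition CB :: "'a::metric_space set set" where
  "CB = {A. A \<noteq> {} \<and> closed A \<and> bounded A}"

(* Intended for A and B in CB, where all suprema and infima involved are over nonempty
   bounded sets of reals and hence are the genuine ones. For B nonempty, infdist x B is
   the infimum of dist x y over y in B. *)
definition hausdorff_dist :: "'a::metric_space set \<Rightarrow> 'a set \<Rightarrow> real" where
  "hausdorff_dist A B = max (SUP x\<in>A. infdist x B) (SUP x\<in>B. infdist x A)"

definition multivalued_Gornicki :: "('a::metric_space \<Rightarrow> 'a set) \<Rightarrow> bool" where
  "multivalued_Gornicki T \<longleftrightarrow>
     (\<forall>x. T x \<in> CB) \<and>
     (\<exists>M::real. 0 \<le> M \<and> M < 1 \<and>
        (\<forall>x y. hausdorff_dist (T x) (T y)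
               \<le> M * (infdist x (T x) + infdist y (T y) + dist x y))) \<and>
     (\<exists>a b::real. 0 \<le> a \<and> a < 1 \<and> 0 \<le> b \<and>
        (\<forall>x. \<exists>u. infdist u (T u) \<le> a * infdist x (T x) \<and>
                 dist u x \<le> b * infdist x (T x)))"

end

theory Submission
  imports Defs
begin

text \<open>Iterating \<open>x \<mapsto> u\<close> from the second condition gives a sequence whose steps and whose
  defects \<open>d(x\<^sub>n, T x\<^sub>n)\<close> decay geometrically. Its limit \<open>z\<close> satisfies
  \<open>d(z, T z) \<le> d(z, x\<^sub>n) + d(x\<^sub>n, T x\<^sub>n) + H(T x\<^sub>n, T z)\<close>; inserting the first condition and
  letting \<open>n\<close> tend to infinity yields \<open>d(z, T z) \<le> M d(z, T z)\<close>, so \<open>d(z, T z) = 0\<close>.\<close>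

text \<open>A real \<open>SUP\<close> bounds its terms only when the image is bounded above. Here,
  for a fixed \<open>b\<close> in \<open>B\<close>, \<open>infdist y B\<close> is at most
  \<open>dist b y\<close>, which is bounded on \<open>A\<close>.\<close>

lemma bdd_above_infdist_image:
  assumes "bounded A" "B \<noteq> {}"
  shows "bdd_above ((\<lambda>x. infdist x B) ` A)"
proof -
  obtain b where b: "b \<in> B" using assms(2) by blast
  obtain e where e: "\<forall>y\<in>A. dist b y \<le> e"
    using assms(1) unfolding bounded_any_center[of A b] by blast
  show ?thesis
  proof (rule bdd_aboveI2)
    fix y assume "y \<in> A"
    then show "infdist y B \<le> e"
      using infdist_le[OF b, of y] e by (fastforce simp: dist_commute)
  qed
qed

text \<open>For \<open>y\<close> in \<open>A\<close>, d(x,B) \<le> d(x,y) + d(y,B), and d(y,B) is at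
  most the first supremum in \<open>hausdorff_dist A B\<close>. Taking the infimum over
  \<open>y\<close> gives the claim.\<close>

lemma infdist_le_infdist_plus_hausdorff_dist:
  assumes "A \<in> CB" "B \<in> CB"
  shows "infdist x B \<le> infdist x A + hausdorff_dist A B"
proof -
  have A: "A \<noteq> {}" "bounded A" and B: "B \<noteq> {}" using assms by (auto simp: CB_def)
  have "infdist x B - hausdorff_dist A B \<le> dist x y" if "y \<in> A" for y
  proof -
    have "infdist y B \<le> (SUP x\<in>A. infdist x B)"
      by (rule cSUP_upper[OF that bdd_above_infdist_image[OF A(2) B]])
    then have "infdist y B \<le> hausdorff_dist A B" by (simp add: hausdorff_dist_def)
    with infdist_triangle[of x B y] show ?thesis by simp
  qed
  then have "infdist x B - hausdorff_dist A B \<le> infdist x A"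
    unfolding infdist_notempty[OF A(1)] by (intro cINF_greatest A(1))
  then show ?thesis by simp
qed

lemma Cauchy_if_geometric_steps:
  fixes s :: "nat \<Rightarrow> 'a::metric_space"
  assumes a: "0 \<le> a" "a < 1" and step: "\<And>n. dist (s n) (s (Suc n)) \<le> C * a ^ n"
  shows "Cauchy s"
proof -
  have C: "0 \<le> C" using order_trans[OF zero_le_dist step[of 0]] by simp
  \<comment> \<open>The exact geometric sum: keeping the subtracted power lets the induction
    telescope, since \<open>C * a ^ m\<close> equals
    \<open>C / (1 - a) * (a ^ m - a ^ Suc m)\<close>.\<close>
  have partial: "dist (s n) (s (n + k)) \<le> C / (1 - a) * (a ^ n - a ^ (n + k))" for n k
  proof (induction k)
    case (Suc k)
    have "dist (s n) (s (n + Suc k)) \<le> dist (s n) (s (n + k)) + dist (s (n + k)) (s (Suc (n + k)))"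
      using dist_triangle by simp
    also have "\<dots> \<le> C / (1 - a) * (a ^ n - a ^ (n + k)) + C * a ^ (n + k)"
      using Suc step by (intro add_mono)
    also have "\<dots> = C / (1 - a) * (a ^ n - a ^ (n + Suc k))"
      using a by (simp add: field_simps)
    finally show ?case .
  qed simp
  have bound: "dist (s n) (s (n + k)) \<le> C / (1 - a) * a ^ n" for n k
    by (rule order_trans[OF partial]) (intro mult_left_mono; use a C in simp)
  have lim: "(\<lambda>n. C / (1 - a) * a ^ n) \<longlonglongrightarrow> 0"
    using a by (auto intro!: tendsto_mult_right_zero LIMSEQ_realpow_zero)
  show ?thesis
    unfolding Cauchy_altdef
  proof (intro allI impI)
    fix e :: real assume "e > 0"
    with lim have "\<forall>\<^sub>F n in sequentially. C / (1 - a) * a ^ n < e"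
      by (rule order_tendstoD)
    then obtain N where N: "\<And>n. n \<ge> N \<Longrightarrow> C / (1 - a) * a ^ n < e"
      by (auto simp: eventually_sequentially)
    have "dist (s m) (s n) < e" if "m \<ge> N" "n > m" for m n
      using bound[of m "n - m"] N[OF that(1)] that by simp
    then show "\<exists>M. \<forall>m\<ge>M. \<forall>n>m. dist (s m) (s n) < e" by blast
  qed
qed

theorem theorem1:
  fixes T :: "'a::complete_space \<Rightarrow> 'a set"
  assumes "multivalued_Gornicki T"
  shows "\<exists>z. z \<in> T z"
proof -
  define f where "f x = infdist x (T x)" for x
  from assms obtain M a b where
    CB: "\<And>x. T x \<in> CB" and M: "M < 1"
    and H: "\<And>x y. hausdorff_dist (T x) (T y) \<le> M * (f x + f y + dist x y)"
    and a: "0 \<le> a" "a < 1" and b: "0 \<le> b"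
    and ex: "\<forall>x. \<exists>u. f u \<le> a * f x \<and> dist u x \<le> b * f x"
    unfolding multivalued_Gornicki_def f_def by (elim conjE exE) metis
  obtain u where u: "\<And>x. f (u x) \<le> a * f x" "\<And>x. dist (u x) x \<le> b * f x"
    using ex by metis
  \<comment> \<open>The starting point is arbitrary; \<open>undefined\<close> merely names some
    point of the space.\<close>
  define s where "s n = (u ^^ n) undefined" for n
  have s_Suc: "s (Suc n) = u (s n)" for n by (simp add: s_def)
  have f_decay: "f (s n) \<le> a ^ n * f (s 0)" for n
  proof (induction n)
    case (Suc n)
    have "f (s (Suc n)) \<le> a * f (s n)" using u(1) by (simp add: s_Suc)
    also have "\<dots> \<le> a * (a ^ n * f (s 0))" by (rule mult_left_mono[OF Suc a(1)])
    finally show ?case by (simp add: mult.assoc)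
  qed simp
  have "dist (s n) (s (Suc n)) \<le> b * f (s 0) * a ^ n" for n
    using order_trans[OF u(2)[of "s n"] mult_left_mono[OF f_decay b]]
    by (simp add: s_Suc dist_commute mult_ac)
  from Cauchy_if_geometric_steps[OF a this] obtain z where z: "s \<longlonglongrightarrow> z"
    using Cauchy_convergent convergent_def by blast
  have d0: "(\<lambda>n. dist (s n) z) \<longlonglongrightarrow> 0" using z tendsto_dist_iff by blast
  have f0: "(\<lambda>n. f (s n)) \<longlonglongrightarrow> 0"
  proof (rule tendsto_sandwich[OF _ _ tendsto_const])
    show "(\<lambda>n. a ^ n * f (s 0)) \<longlonglongrightarrow> 0"
      using a by (auto intro!: tendsto_mult_left_zero LIMSEQ_realpow_zero)
  qed (auto simp: f_decay, simp add: f_def infdist_nonneg)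
  \<comment> \<open>Pass from \<open>z\<close> to \<open>s n\<close> by the triangle inequality,
    then from \<open>T (s n)\<close> to \<open>T z\<close> by the Hausdorff estimate. On the right
    only \<open>M * f z\<close> survives the limit, and \<open>M < 1\<close> absorbs it.\<close>
  have "f z \<le> dist (s n) z + f (s n) + M * (f (s n) + f z + dist (s n) z)" for n
    using infdist_triangle[of z "T z" "s n"]
      infdist_le_infdist_plus_hausdorff_dist[OF CB CB, of "s n" z "s n"] H[of "s n" z]
    by (simp add: f_def dist_commute)
  moreover have "(\<lambda>n. dist (s n) z + f (s n) + M * (f (s n) + f z + dist (s n) z))
      \<longlonglongrightarrow> 0 + 0 + M * (0 + f z + 0)"
    by (intro tendsto_intros d0 f0)
  ultimately have "f z \<le> 0 + 0 + M * (0 + f z + 0)"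
    by (intro LIMSEQ_le_const) auto
  then have "(1 - M) * f z \<le> 0" by (simp add: algebra_simps)
  then have "f z \<le> 0" using M by (simp add: mult_le_0_iff)
  then have "infdist z (T z) = 0" using infdist_nonneg[of z "T z"] by (simp add: f_def)
  \<comment> \<open>Zero distance means membership because \<open>T z\<close> is closed and
    nonempty.\<close>
  then have "z \<in> T z"
    using CB[of z] in_closed_iff_infdist_zero[of "T z" z] by (auto simp: CB_def)
  then show ?thesis ..
qed

end
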